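(* Let $F$ and $G$ be 1-sorted species with $F$ strictly finite. Then there is a natural isomorphism between the functors $F(G[\,\cdot\,])$ (the analytic functor of $F$ composed with the functor $G$) and $F\boxtimes G$ (the inner plethysm of the species $F$ and $G$).
   Context: $\mathbb{B}$ is the category of finite sets and bijections; a 1-sorted species is a functor $\mathbb{B}\to\mathbb{B}$, a 2-sorted species is a functor $\mathbb{B}^2\to\mathbb{B}$. $[n]=\{1,\dots,n\}$, $F[n]=F[[n]]$; $F$ is strictly finite if $F[n]=\emptyset$ for all large $n$. The analytic functor of $F$ is, for a set $A$, $F(A)=\sum_{n\ge0}(F[n]\times A^n)/\mathfrak{S}_n$ (disjoint union of orbit sets), where $A^n$ is the set of functions $[n]\to A$, $\sigma\cdot(t,f)=(F[\sigma](t),f\circ\sigma^{-1})$; a function $g:A\to B$ sends the orbit of $(t,f)$ to the orbit of $(t,g\circ f)$. Since $F$ is strictly finite, $F(A)$ is finite for finite $A$, so $A\mapsto F(G[A])$ is a species. For a 2-sorted species $K(X,Y)$ and a 1-sorted species $F(X)$, regarded as 2-sorted with no points of sort $Y$, the Cartesian product in $X$ is $(F\times_X K)[U,V]=F[U]\times K[U,V]$, and the scalar product in $X$, $\langle F,K\rangle_X=(F\times_X K)|_{X=1}$, is the species of structures with the $X$-points unlabeled: $\langle F,K\rangle_X[V]=\sum_{n\ge0}(F[n]\times K[[n],V])/\mathfrak{S}_n$. For a 1-sorted species $G$, $\Phi(G)[U,V]$ is the set of all functions from $U$ to $G[V]$, with transport $f\mapsto G[\sigma]\circ f\circ\beta^{-1}$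 along bijections $(\beta,\sigma)$. The inner plethysm is $(F\boxtimes G)(Y)=\langle F(X),\Phi(G)(X,Y)\rangle_X$. *)

theory Defs
  imports
    "HOL-Library.FuncSet"
    "HOL-Algebra.Group_Action"
    "HOL-Algebra.Sym_Groups"
begin

section \<open>Species\<close>

text \<open>
  Label sets are the finite subsets of a label type, structures are elements of a structure type.
  A bijection \<open>\<sigma> : U \<rightarrow> V\<close> is given by \<open>U\<close> together with a function that is injective on \<open>U\<close> and
  has image \<open>V\<close>; the last clauses of \<open>species\<close> and \<open>species2\<close> say that the values of that function
  outside \<open>U\<close> are irrelevant.
\<close>

record ('a, 's) species_data =
  structs :: "'a set \<Rightarrow> 's set"
  transport :: "'a set \<Rightarrow> ('a \<Rightarrow> 'a) \<Rightarrow> 's \<Rightarrow> 's"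

definition species :: "('a, 's) species_data \<Rightarrow> bool" where
  "species F \<longleftrightarrow>
    (\<forall>U. finite U \<longrightarrow> finite (structs F U)) \<and>
    (\<forall>U V \<sigma>. finite U \<longrightarrow> bij_betw \<sigma> U V \<longrightarrow>
        bij_betw (transport F U \<sigma>) (structs F U) (structs F V)) \<and>
    (\<forall>U. \<forall>s\<in>structs F U. finite U \<longrightarrow> transport F U id s = s) \<and>
    (\<forall>U V W \<sigma> \<tau>. \<forall>s\<in>structs F U. finite U \<longrightarrow> bij_betw \<sigma> U V \<longrightarrow> bij_betw \<tau> V W \<longrightarrow>
        transport F U (\<tau> \<circ> \<sigma>) s = transport F V \<tau> (transport F U \<sigma> s)) \<and>
    (\<forall>U V \<sigma> \<sigma>'. \<forall>s\<in>structs F U. finite U \<longrightarrow> bij_betw \<sigma> U V \<longrightarrow> (\<forall>u\<in>U. \<sigma> u = \<sigma>' u) \<longrightarrow>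
        transport F U \<sigma> s = transport F U \<sigma>' s)"

lemma speciesD:
  assumes "species G" "finite U"
  shows "finite (structs G U)"
    "bij_betw \<sigma> U V \<Longrightarrow> bij_betw (transport G U \<sigma>) (structs G U) (structs G V)"
    "s \<in> structs G U \<Longrightarrow> transport G U id s = s"
    "s \<in> structs G U \<Longrightarrow> bij_betw \<sigma> U V \<Longrightarrow> bij_betw \<tau> V W \<Longrightarrow> transport G U (\<tau> \<circ> \<sigma>) s = transport G V \<tau> (transport G U \<sigma> s)"
    "s \<in> structs G U \<Longrightarrow> bij_betw \<sigma> U V \<Longrightarrow> (\<And>u. u\<in>U \<Longrightarrow> \<sigma> u = \<sigma>' u) \<Longrightarrow> transport G U \<sigma> s = transport G U \<sigma>' s"
  using assms unfolding species_def by simp_all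

record ('x, 'y, 's) species2_data =
  structs2 :: "'x set \<Rightarrow> 'y set \<Rightarrow> 's set"
  transport2 :: "'x set \<Rightarrow> 'y set \<Rightarrow> ('x \<Rightarrow> 'x) \<Rightarrow> ('y \<Rightarrow> 'y) \<Rightarrow> 's \<Rightarrow> 's"

definition species2 :: "('x, 'y, 's) species2_data \<Rightarrow> bool" where
  "species2 K \<longleftrightarrow>
    (\<forall>U V. finite U \<longrightarrow> finite V \<longrightarrow> finite (structs2 K U V)) \<and>
    (\<forall>U U' V V' \<beta> \<sigma>. finite U \<longrightarrow> finite V \<longrightarrow> bij_betw \<beta> U U' \<longrightarrow> bij_betw \<sigma> V V' \<longrightarrow>
        bij_betw (transport2 K U V \<beta> \<sigma>) (structs2 K U V) (structs2 K U' V')) \<and>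
    (\<forall>U V. \<forall>s\<in>structs2 K U V. finite U \<longrightarrow> finite V \<longrightarrow> transport2 K U V id id s = s) \<and>
    (\<forall>U U' U'' V V' V'' \<beta> \<beta>' \<sigma> \<sigma>'. \<forall>s\<in>structs2 K U V. finite U \<longrightarrow> finite V \<longrightarrow>
        bij_betw \<beta> U U' \<longrightarrow> bij_betw \<beta>' U' U'' \<longrightarrow> bij_betw \<sigma> V V' \<longrightarrow> bij_betw \<sigma>' V' V'' \<longrightarrow>
        transport2 K U V (\<beta>' \<circ> \<beta>) (\<sigma>' \<circ> \<sigma>) s = transport2 K U' V' \<beta>' \<sigma>' (transport2 K U V \<beta> \<sigma> s)) \<and>
    (\<forall>U U' V V' \<beta> \<beta>' \<sigma> \<sigma>'. \<forall>s\<in>structs2 K U V. finite U \<longrightarrow> finite V \<longrightarrow>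
        bij_betw \<beta> U U' \<longrightarrow> bij_betw \<sigma> V V' \<longrightarrow>
        (\<forall>u\<in>U. \<beta> u = \<beta>' u) \<longrightarrow> (\<forall>v\<in>V. \<sigma> v = \<sigma>' v) \<longrightarrow>
        transport2 K U V \<beta> \<sigma> s = transport2 K U V \<beta>' \<sigma>' s)"

text \<open>Natural isomorphisms between the underlying functors.\<close>

definition species_iso ::
    "('a set \<Rightarrow> 's \<Rightarrow> 't) \<Rightarrow> ('a, 's) species_data \<Rightarrow> ('a, 't) species_data \<Rightarrow> bool" where
  "species_iso \<alpha> F G \<longleftrightarrow>
    (\<forall>U. finite U \<longrightarrow> bij_betw (\<alpha> U) (structs F U) (structs G U)) \<and>
    (\<forall>U V \<sigma>. \<forall>s\<in>structs F U. finite U \<longrightarrow> bij_betw \<sigma> U V \<longrightarrow>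
        \<alpha> V (transport F U \<sigma> s) = transport G U \<sigma> (\<alpha> U s))"

definition strictly_finite :: "(nat, 's) species_data \<Rightarrow> bool" where
  "strictly_finite F \<longleftrightarrow> (\<forall>\<^sub>F n in sequentially. structs F {1..n} = {})"


section \<open>Analytic functors\<close>

text \<open>
  \<open>A\<^sup>n\<close> is the set \<open>{1..n} \<rightarrow>\<^sub>E A\<close>, and \<open>compose {1..n} f (inv_into {1..n} \<sigma>)\<close> is
  \<open>f \<circ> \<sigma>\<inverse>\<close> in this representation. An element of the disjoint union over \<open>n\<close> is a pair
  of \<open>n\<close> and an orbit.
\<close>

definition analytic_action ::
    "(nat, 's) species_data \<Rightarrow> nat \<Rightarrow> (nat \<Rightarrow> nat) \<Rightarrow> 's \<times> (nat \<Rightarrow> 'c) \<Rightarrow> 's \<times> (nat \<Rightarrow> 'c)" where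
  "analytic_action F n \<sigma> = (\<lambda>(t, f). (transport F {1..n} \<sigma> t, compose {1..n} f (inv_into {1..n} \<sigma>)))"

definition analytic_obj ::
    "(nat, 's) species_data \<Rightarrow> 'c set \<Rightarrow> (nat \<times> ('s \<times> (nat \<Rightarrow> 'c)) set) set" where
  "analytic_obj F A =
    (SIGMA n:UNIV. orbits (sym_group n) (structs F {1..n} \<times> ({1..n} \<rightarrow>\<^sub>E A)) (analytic_action F n))"

text \<open>The image of the orbit of \<open>(t, f)\<close> is the orbit of \<open>(t, g \<circ> f)\<close>; see
  \<open>analytic_map_orbit\<close> below.\<close>

definition analytic_map ::
    "('c \<Rightarrow> 'd) \<Rightarrow> nat \<times> ('s \<times> (nat \<Rightarrow> 'c)) set \<Rightarrow> nat \<times> ('s \<times> (nat \<Rightarrow> 'd)) set" where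
  "analytic_map g = (\<lambda>(n, Q). (n, (\<lambda>(t, f). (t, compose {1..n} g f)) ` Q))"

lemma analytic_map_orbit:
  "analytic_map g (n, orbit (sym_group n) (analytic_action F n) (t, f)) =
    (n, orbit (sym_group n) (analytic_action F n) (t, compose {1..n} g f))"
proof -
  have "compose {1..n} g (compose {1..n} f (inv_into {1..n} \<sigma>)) =
      compose {1..n} (compose {1..n} g f) (inv_into {1..n} \<sigma>)" if "\<sigma> permutes {1..n}" for \<sigma>
    using inv_into_into[of _ \<sigma> "{1..n}"] permutes_image[OF that]
    by (fastforce simp: compose_def fun_eq_iff)
  then show ?thesis
    unfolding analytic_map_def orbit_def analytic_action_def sym_group_def
    by (auto simp: image_def; metis)
qed

definition analytic_comp ::
    "(nat, 's) species_data \<Rightarrow> ('b, 'g) species_data \<Rightarrow>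
      ('b, nat \<times> ('s \<times> (nat \<Rightarrow> 'g)) set) species_data"
    (infixl \<open>\<circ>\<^sub>A\<close> 70) where
  "F \<circ>\<^sub>A G =
    \<lparr>structs = (\<lambda>V. analytic_obj F (structs G V)),
     transport = (\<lambda>V \<sigma>. analytic_map (transport G V \<sigma>))\<rparr>"


section \<open>Inner plethysm\<close>

definition cart_X ::
    "('x, 's) species_data \<Rightarrow> ('x, 'y, 'k) species2_data \<Rightarrow> ('x, 'y, 's \<times> 'k) species2_data"
    (infixr \<open>\<times>\<^sub>X\<close> 75) where
  "F \<times>\<^sub>X K =
    \<lparr>structs2 = (\<lambda>U V. structs F U \<times> structs2 K U V),
     transport2 = (\<lambda>U V \<beta> \<sigma>. map_prod (transport F U \<beta>) (transport2 K U V \<beta> \<sigma>))\<rparr>"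

text \<open>The species \<open>H|\<^sub>X\<^sub>=\<^sub>1\<close> of \<open>H\<close>-structures with unlabeled \<open>X\<close>-points. Transport
  acts on orbits by taking images, as transport along \<open>\<sigma>\<close> commutes with the action on \<open>X\<close>-points.\<close>

definition unlabel_X ::
    "(nat, 'y, 'h) species2_data \<Rightarrow> ('y, nat \<times> 'h set) species_data" where
  "unlabel_X H =
    \<lparr>structs = (\<lambda>V. SIGMA n:UNIV.
        orbits (sym_group n) (structs2 H {1..n} V) (\<lambda>\<pi>. transport2 H {1..n} V \<pi> id)),
     transport = (\<lambda>V \<sigma> (n, Q). (n, transport2 H {1..n} V id \<sigma> ` Q))\<rparr>"

definition scalar_X ::
    "(nat, 's) species_data \<Rightarrow> (nat, 'y, 'k) species2_data \<Rightarrow> ('y, nat \<times> ('s \<times> 'k) set) species_data"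
    (\<open>\<langle>_,_\<rangle>\<^sub>X\<close>) where
  "\<langle>F, K\<rangle>\<^sub>X = unlabel_X (F \<times>\<^sub>X K)"

definition Phi :: "('y, 'g) species_data \<Rightarrow> ('x, 'y, 'x \<Rightarrow> 'g) species2_data" where
  "Phi G =
    \<lparr>structs2 = (\<lambda>U V. U \<rightarrow>\<^sub>E structs G V),
     transport2 = (\<lambda>U V \<beta> \<sigma> f. compose (\<beta> ` U) (transport G V \<sigma> \<circ> f) (inv_into U \<beta>))\<rparr>"

lemma bij_betw_compose_PiE:
  assumes b: "bij_betw \<beta> U U'" and g: "bij_betw g A B"
  shows "bij_betw (\<lambda>f. compose (\<beta> ` U) (g \<circ> f) (inv_into U \<beta>)) (U \<rightarrow>\<^sub>E A) (U' \<rightarrow>\<^sub>E B)"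
proof (rule bij_betw_byWitness[where f' = "\<lambda>h. compose U (inv_into A g \<circ> h) \<beta>"])
  have U': "U' = \<beta> ` U" and i: "inj_on \<beta> U" using b by (auto simp: bij_betw_def)
  have gi: "inj_on g A" "g ` A = B" using g by (auto simp: bij_betw_def)
  show "\<forall>a\<in>U \<rightarrow>\<^sub>E A. compose U (inv_into A g \<circ> compose (\<beta> ` U) (g \<circ> a) (inv_into U \<beta>)) \<beta> = a"
    using i gi by (auto simp: compose_def fun_eq_iff PiE_def extensional_def Pi_def)
  show "\<forall>a'\<in>U' \<rightarrow>\<^sub>E B. compose (\<beta> ` U) (g \<circ> compose U (inv_into A g \<circ> a') \<beta>) (inv_into U \<beta>) = a'"
    unfolding U' using i gi 
    by (auto simp: compose_def fun_eq_iff PiE_def extensional_def Pi_def f_inv_into_f)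
  show "(\<lambda>f. compose (\<beta> ` U) (g \<circ> f) (inv_into U \<beta>)) ` (U \<rightarrow>\<^sub>E A) \<subseteq> U' \<rightarrow>\<^sub>E B"
    unfolding U' using i gi(2) by (auto simp: compose_def PiE_def extensional_def Pi_def)
  show "(\<lambda>h. compose U (inv_into A g \<circ> h) \<beta>) ` (U' \<rightarrow>\<^sub>E B) \<subseteq> U \<rightarrow>\<^sub>E A"
    unfolding U' using inv_into_into[of _ g A] gi(2) by (auto simp: compose_def PiE_def extensional_def Pi_def)
qed

lemma species2_Phi: assumes G: "species G" shows "species2 (Phi G :: ('x,'y,'x \<Rightarrow> 'g) species2_data)"
proof -
  let ?P = "Phi G :: ('x,'y,'x \<Rightarrow> 'g) species2_data"
  have 1: "finite (structs2 ?P U V)" if f: "finite U" "finite V" for U V 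
    using f speciesD(1)[OF G] by (auto simp: Phi_def intro!: finite_PiE)
  have 2: "bij_betw (transport2 ?P U V \<beta> \<sigma>) (structs2 ?P U V) (structs2 ?P U' V')"
    if f: "finite U" "finite V" and b: "bij_betw \<beta> U U'" "bij_betw \<sigma> V V'" for U V U' V' \<beta> \<sigma>
    using bij_betw_compose_PiE[OF b(1) speciesD(2)[OF G f(2) b(2)]] by (simp add: Phi_def)
  have 3: "transport2 ?P U V id id s = s" if f: "finite U" "finite V" and s: "s \<in> structs2 ?P U V" for U V s
  proof -
    have e: "s \<in> U \<rightarrow>\<^sub>E structs G V" using s by (simp add: Phi_def)
    have "transport G V id (s x) = s x" if "x \<in> U" for x
      using speciesD(3)[OF G f(2)] e that by auto
    moreover have "s x = undefined" if "x \<notin> U" for x using e that by auto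
    moreover have "inv_into U id x = x" if "x \<in> U" for x using that inv_into_f_f[of id U x] by simp
    ultimately show ?thesis by (simp add: Phi_def compose_def fun_eq_iff)
  qed
  have 4: "transport2 ?P U V (\<beta>' \<circ> \<beta>) (\<sigma>' \<circ> \<sigma>) s = transport2 ?P U' V' \<beta>' \<sigma>' (transport2 ?P U V \<beta> \<sigma> s)"
    if f: "finite U" "finite V" and s: "s \<in> structs2 ?P U V" and b: "bij_betw \<beta> U U'" and s1: "bij_betw \<sigma> V V'"
    and b': "bij_betw \<beta>' U' U''" "bij_betw \<sigma>' V' V''" for U V U' V' U'' V'' \<beta> \<beta>' \<sigma> \<sigma>' s
  proof -
    have e: "s \<in> U \<rightarrow>\<^sub>E structs G V" using s by (simp add: Phi_def)
    have i: "inj_on \<beta> U" and U': "U' = \<beta> ` U" using b by (auto simp: bij_betw_def)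
    then have i': "inj_on \<beta>' (\<beta> ` U)" using b' by (auto simp: bij_betw_def)
    have "transport G V (\<sigma>' \<circ> \<sigma>) (s x) = transport G V' \<sigma>' (transport G V \<sigma> (s x))" if "x \<in> U" for x
      using speciesD(4)[OF G f(2) _ s1 b'(2)] e that by auto
    moreover have "inv_into U (\<beta>' \<circ> \<beta>) (\<beta>' (\<beta> x)) = x" if "x \<in> U" for x
      using that i i' comp_inj_on[OF i i'] by (metis comp_apply inv_into_f_f)
    moreover have "inv_into U' \<beta>' (\<beta>' (\<beta> x)) = \<beta> x" "inv_into U \<beta> (\<beta> x) = x" if "x \<in> U" for x
      using that i i' U' by auto
    ultimately show ?thesis unfolding U' by (auto simp: Phi_def compose_def restrict_def fun_eq_iff)
  qed
  have 5: "transport2 ?P U V \<beta> \<sigma> s = transport2 ?P U V \<beta>' \<sigma>' s"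
    if f: "finite U" "finite V" and s: "s \<in> structs2 ?P U V" and b: "bij_betw \<beta> U U'" and s1: "bij_betw \<sigma> V V'"
    and a: "\<forall>u\<in>U. \<beta> u = \<beta>' u" "\<forall>v\<in>V. \<sigma> v = \<sigma>' v" for U V U' V' \<beta> \<beta>' \<sigma> \<sigma>' s
  proof -
    have e: "s \<in> U \<rightarrow>\<^sub>E structs G V" using s by (simp add: Phi_def)
    have i: "inj_on \<beta> U" using b by (auto simp: bij_betw_def)
    have i': "inj_on \<beta>' U" and im: "\<beta> ` U = \<beta>' ` U" using i a inj_on_cong[of U \<beta> \<beta>'] by auto
    have t: "transport G V \<sigma> (s x) = transport G V \<sigma>' (s x)" if "x \<in> U" for x
      using speciesD(5)[OF G f(2) _ s1, of "s x" \<sigma>'] a e that by auto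
    have "inv_into U \<beta> y = inv_into U \<beta>' y" "inv_into U \<beta> y \<in> U" if y: "y \<in> \<beta>' ` U" for y
    proof -
      obtain x where x: "x \<in> U" "y = \<beta>' x" using y by auto
      then have "y = \<beta> x" using a by simp
      then show "inv_into U \<beta> y = inv_into U \<beta>' y" "inv_into U \<beta> y \<in> U" using inv_into_f_f[OF i x(1)] inv_into_f_f[OF i' x(1)] x by simp_all
    qed
    then show ?thesis using t im by (auto simp: Phi_def compose_def restrict_def fun_eq_iff)
  qed
  show ?thesis unfolding species2_def
    by (intro conjI allI impI ballI) (rule 1 2 3 4 5; assumption)+
qed

lemma species2_cart: assumes F: "species F" and K: "species2 K" shows "species2 (F \<times>\<^sub>X K)"
proof -
  note D = speciesD[OF F] and K' = K[unfolded species2_def]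
  note K1 = K'[THEN conjunct1, rule_format]
    and K2 = K'[THEN conjunct2, THEN conjunct1, rule_format]
    and K3 = K'[THEN conjunct2, THEN conjunct2, THEN conjunct1, rule_format]
    and K4 = K'[THEN conjunct2, THEN conjunct2, THEN conjunct2, THEN conjunct1, rule_format]
    and K5 = K'[THEN conjunct2, THEN conjunct2, THEN conjunct2, THEN conjunct2, rule_format]
  show ?thesis unfolding species2_def
  proof (intro conjI allI impI ballI, goal_cases)
    case 1 then show ?case using D(1) K1 by (simp add: cart_X_def)
  next
    case 2 then show ?case using D(2) K2 by (simp add: cart_X_def bij_betw_map_prod)
  next
    case (3 U V s) then show ?case using D(3) K3 by (cases s) (simp add: cart_X_def)
  next
    case (4 U U' U'' V V' V'' \<beta> \<beta>' \<sigma> \<sigma>' s)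
    obtain a b where s: "s = (a, b)" and a: "a \<in> structs F U" and b: "b \<in> structs2 K U V"
      using 4(1) by (auto simp: cart_X_def)
    have "transport2 K U V (\<beta>' \<circ> \<beta>) (\<sigma>' \<circ> \<sigma>) b = transport2 K U' V' \<beta>' \<sigma>' (transport2 K U V \<beta> \<sigma> b)"
      by (rule K4[OF b 4(2-7)])
    then show ?case using D(4)[OF 4(2) a 4(4,5)] by (simp add: cart_X_def s)
  next
    case (5 U U' V V' \<beta> \<beta>' \<sigma> \<sigma>' s)
    obtain a b where s: "s = (a, b)" and a: "a \<in> structs F U" and b: "b \<in> structs2 K U V"
      using 5(1) by (auto simp: cart_X_def)
    have "transport2 K U V \<beta> \<sigma> b = transport2 K U V \<beta>' \<sigma>' b"
      by (rule K5[OF b 5(2-5)]) (use 5 in auto)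
    then show ?case using D(5)[OF 5(2) a 5(4)] 5(6) by (simp add: cart_X_def s)
  qed
qed

definition inner_plethysm ::
    "(nat, 's) species_data \<Rightarrow> ('b, 'g) species_data \<Rightarrow>
      ('b, nat \<times> ('s \<times> (nat \<Rightarrow> 'g)) set) species_data"
    (infixl \<open>\<boxtimes>\<close> 70) where
  "F \<boxtimes> G = \<langle>F, Phi G\<rangle>\<^sub>X"

end

theory Submission
  imports Defs
begin

text \<open>
  On finite label sets both functors have literally the same structures and transports:
  \<open>\<Phi>(G)[[n], V]\<close> is \<open>G[V]\<^sup>n\<close>, and \<open>\<SS>\<^sub>n\<close> acts on it through \<open>\<Phi>(G)\<close> by \<open>f \<mapsto> f \<circ> \<sigma>\<inverse>\<close>. Hence the
  natural isomorphism is the identity. Strict finiteness only serves to make the structure sets finite.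
\<close>

section \<open>Species\<close>

text \<open>Functoriality makes transport along the inverse bijection a two-sided inverse, so
  bijectivity of \<open>transport\<close> follows once it maps structures to structures.\<close>

lemma speciesI:
  assumes fin: "\<And>U. finite U \<Longrightarrow> finite (structs F U)"
    and into: "\<And>U V \<sigma> s. finite U \<Longrightarrow> bij_betw \<sigma> U V \<Longrightarrow> s \<in> structs F U \<Longrightarrow>
      transport F U \<sigma> s \<in> structs F V"
    and ident: "\<And>U s. finite U \<Longrightarrow> s \<in> structs F U \<Longrightarrow> transport F U id s = s"
    and comp: "\<And>U V W \<sigma> \<tau> s. finite U \<Longrightarrow> s \<in> structs F U \<Longrightarrow> bij_betw \<sigma> U V \<Longrightarrow> bij_betw \<tau> V W \<Longrightarrow>
      transport F U (\<tau> \<circ> \<sigma>) s = transport F V \<tau> (transport F U \<sigma> s)"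
    and cong: "\<And>U V \<sigma> \<sigma>' s. finite U \<Longrightarrow> s \<in> structs F U \<Longrightarrow> bij_betw \<sigma> U V \<Longrightarrow>
      (\<And>u. u \<in> U \<Longrightarrow> \<sigma> u = \<sigma>' u) \<Longrightarrow> transport F U \<sigma> s = transport F U \<sigma>' s"
  shows "species F"
proof -
  have retract: "transport F V \<tau> (transport F U \<sigma> s) = s"
    if "finite U" "bij_betw \<sigma> U V" "bij_betw \<tau> V U" "\<And>u. u \<in> U \<Longrightarrow> \<tau> (\<sigma> u) = u"
      "s \<in> structs F U" for U V \<sigma> \<tau> s
  proof -
    have "transport F V \<tau> (transport F U \<sigma> s) = transport F U (\<tau> \<circ> \<sigma>) s"
      using comp that by simp
    \<comment> \<open>\<open>\<tau> \<circ> \<sigma>\<close> agrees with \<open>id\<close> only on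
      \<open>U\<close>, so the congruence clause comes before the identity law.\<close>
    also have "\<dots> = transport F U id s"
      by (rule cong[OF that(1,5) bij_betw_trans[OF that(2,3)]]) (simp add: that(4))
    finally show ?thesis using ident that by simp
  qed
  have bij: "bij_betw (transport F U \<sigma>) (structs F U) (structs F V)"
    if U: "finite U" and \<sigma>: "bij_betw \<sigma> U V" for U V \<sigma>
  proof -
    have V: "finite V" using bij_betw_finite[OF \<sigma>] U by simp
    have \<tau>: "bij_betw (inv_into U \<sigma>) V U" by (rule bij_betw_inv_into[OF \<sigma>])
    show ?thesis
    proof (rule bij_betw_byWitness[where f' = "transport F V (inv_into U \<sigma>)"])
      show "\<forall>s\<in>structs F U. transport F V (inv_into U \<sigma>) (transport F U \<sigma> s) = s"
        using retract[OF U \<sigma> \<tau>] bij_betw_inv_into_left[OF \<sigma>] by blast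
      \<comment> \<open>This is \<open>retract\<close> started from \<open>V\<close>, with \<sigma>
        and its inverse exchanged.\<close>
      show "\<forall>s\<in>structs F V. transport F U \<sigma> (transport F V (inv_into U \<sigma>) s) = s"
        using retract[OF V \<tau> \<sigma>] bij_betw_inv_into_right[OF \<sigma>] by blast
    qed (use into U V \<sigma> \<tau> in blast)+
  qed
  show ?thesis
    unfolding species_def
    by (intro conjI allI impI ballI) (rule fin bij ident comp cong; (assumption | simp))+
qed

text \<open>Two records may agree on all structures over finite sets without being equal, as their
  values on infinite label sets and on non-structures are arbitrary. The axioms see only the common
  part and hence carry over.\<close>

lemma species_cong:
  fixes F G :: "('a, 's) species_data"
  assumes F: "species F"
    and s: "\<And>U. finite U \<Longrightarrow> structs F U = structs G U"
    and t: "\<And>U V \<sigma> s. finite U \<Longrightarrow> bij_betw \<sigma> U V \<Longrightarrow> s \<in> structs F U \<Longrightarrow>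
      transport F U \<sigma> s = transport G U \<sigma> s"
  shows "species G"
proof (rule speciesI)
  fix U V :: "'a set" and \<sigma> s
  assume U: "finite U" and b: "bij_betw \<sigma> U V" and "s \<in> structs G U"
  moreover have "finite V" using bij_betw_finite[OF b] U by simp
  ultimately show "transport G U \<sigma> s \<in> structs G V"
    using bij_betwE[OF speciesD(2)[OF F U b]] s t[OF U b] by auto
next
  fix U V W :: "'a set" and \<sigma> \<tau> s
  assume U: "finite U" and sG: "s \<in> structs G U" and b: "bij_betw \<sigma> U V" "bij_betw \<tau> V W"
  have V: "finite V" using bij_betw_finite[OF b(1)] U by simp
  have sF: "s \<in> structs F U" using s U sG by simp
  \<comment> \<open>The outer transport is rewritten by \<open>t\<close> over \<open>V\<close>,
    which requires the intermediate structure to belong to \<open>structs F V\<close>.\<close>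
  then have "transport F U \<sigma> s \<in> structs F V"
    using bij_betwE[OF speciesD(2)[OF F U b(1)]] by blast
  then show "transport G U (\<tau> \<circ> \<sigma>) s = transport G V \<tau> (transport G U \<sigma> s)"
    using speciesD(4)[OF F U sF b] t[OF U bij_betw_trans[OF b] sF] t[OF U b(1) sF] t[OF V b(2)]
    by simp
next
  fix U V :: "'a set" and \<sigma> \<sigma>' s
  assume U: "finite U" and sG: "s \<in> structs G U" and b: "bij_betw \<sigma> U V"
    and eq: "\<And>u. u \<in> U \<Longrightarrow> \<sigma> u = \<sigma>' u"
  have sF: "s \<in> structs F U" using s U sG by simp
  \<comment> \<open>\<open>t\<close> has to be applied along \<sigma>' too, so bijectivity is passed
    on from \<sigma>.\<close>
  have "bij_betw \<sigma>' U V" using b bij_betw_cong[of U \<sigma> \<sigma>' V] eq by simp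
  then show "transport G U \<sigma> s = transport G U \<sigma>' s"
    using speciesD(5)[OF F U sF b eq] t[OF U _ sF] b by simp
next
  fix U s assume "finite U" "s \<in> structs G U"
  then show "transport G U id s = s"
    using speciesD(3)[OF F, of U s] s t[of U id U s] by simp
qed (use speciesD(1)[OF F] s in simp)

text \<open>For identity maps, bijectivity is equality of the structure sets and naturality is
  agreement of the transports.\<close>

lemma species_iso_identity:
  assumes "\<And>U. finite U \<Longrightarrow> structs F U = structs G U"
    and "\<And>U V \<sigma> s. finite U \<Longrightarrow> bij_betw \<sigma> U V \<Longrightarrow> s \<in> structs F U \<Longrightarrow>
      transport F U \<sigma> s = transport G U \<sigma> s"
  shows "species_iso (\<lambda>U s. s) F G"
  using assms unfolding species_iso_def by (auto simp: bij_betw_def)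

section \<open>Axioms of two-sorted species as rules\<close>

lemma species2D:
  assumes "species2 K" "finite U" "finite V"
  shows "finite (structs2 K U V)"
    and "bij_betw \<beta> U U' \<Longrightarrow> bij_betw \<sigma> V V' \<Longrightarrow>
      bij_betw (transport2 K U V \<beta> \<sigma>) (structs2 K U V) (structs2 K U' V')"
    and "s \<in> structs2 K U V \<Longrightarrow> transport2 K U V id id s = s"
    and "s \<in> structs2 K U V \<Longrightarrow> bij_betw \<beta> U U' \<Longrightarrow> bij_betw \<beta>' U' U'' \<Longrightarrow>
      bij_betw \<sigma> V V' \<Longrightarrow> bij_betw \<sigma>' V' V'' \<Longrightarrow>
      transport2 K U V (\<beta>' \<circ> \<beta>) (\<sigma>' \<circ> \<sigma>) s = transport2 K U' V' \<beta>' \<sigma>' (transport2 K U V \<beta> \<sigma> s)"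
    and "s \<in> structs2 K U V \<Longrightarrow> bij_betw \<beta> U U' \<Longrightarrow> bij_betw \<sigma> V V' \<Longrightarrow>
      (\<And>u. u \<in> U \<Longrightarrow> \<beta> u = \<beta>' u) \<Longrightarrow> (\<And>v. v \<in> V \<Longrightarrow> \<sigma> v = \<sigma>' v) \<Longrightarrow>
      transport2 K U V \<beta> \<sigma> s = transport2 K U V \<beta>' \<sigma>' s"
proof -
  note K = assms(1)[unfolded species2_def]
  show "finite (structs2 K U V)"
    by (rule K[THEN conjunct1, rule_format, OF assms(2,3)])
  show "bij_betw \<beta> U U' \<Longrightarrow> bij_betw \<sigma> V V' \<Longrightarrow>
      bij_betw (transport2 K U V \<beta> \<sigma>) (structs2 K U V) (structs2 K U' V')"
    by (rule K[THEN conjunct2, THEN conjunct1, rule_format, OF assms(2,3)])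
  show "s \<in> structs2 K U V \<Longrightarrow> transport2 K U V id id s = s"
    by (rule K[THEN conjunct2, THEN conjunct2, THEN conjunct1, rule_format, OF _ assms(2,3)])
  show "s \<in> structs2 K U V \<Longrightarrow> bij_betw \<beta> U U' \<Longrightarrow> bij_betw \<beta>' U' U'' \<Longrightarrow>
      bij_betw \<sigma> V V' \<Longrightarrow> bij_betw \<sigma>' V' V'' \<Longrightarrow>
      transport2 K U V (\<beta>' \<circ> \<beta>) (\<sigma>' \<circ> \<sigma>) s = transport2 K U' V' \<beta>' \<sigma>' (transport2 K U V \<beta> \<sigma> s)"
    by (rule K[THEN conjunct2, THEN conjunct2, THEN conjunct2, THEN conjunct1, rule_format,
          OF _ assms(2,3)])
  show "s \<in> structs2 K U V \<Longrightarrow> bij_betw \<beta> U U' \<Longrightarrow> bij_betw \<sigma> V V' \<Longrightarrow>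
      (\<And>u. u \<in> U \<Longrightarrow> \<beta> u = \<beta>' u) \<Longrightarrow> (\<And>v. v \<in> V \<Longrightarrow> \<sigma> v = \<sigma>' v) \<Longrightarrow>
      transport2 K U V \<beta> \<sigma> s = transport2 K U V \<beta>' \<sigma>' s"
    by (rule K[THEN conjunct2, THEN conjunct2, THEN conjunct2, THEN conjunct2, rule_format,
          OF _ assms(2,3)])
qed

section \<open>Orbits and unlabeled points\<close>

text \<open>\<open>orbit G \<phi> x\<close> consists of the values \<open>\<phi> g x\<close> with
  \<open>g\<close> in the carrier, so only values of the action on \<open>E\<close> enter.\<close>

lemma orbits_cong:
  assumes "\<And>g x. g \<in> carrier G \<Longrightarrow> x \<in> E \<Longrightarrow> \<phi> g x = \<psi> g x"
  shows "orbits G E \<phi> = orbits G E \<psi>"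
proof -
  have "orbit G \<phi> x = orbit G \<psi> x" if "x \<in> E" for x
    unfolding orbit_def Setcompr_eq_image using assms that by (intro image_cong) auto
  then show ?thesis unfolding orbits_def Setcompr_eq_image by (intro image_cong) auto
qed

lemma orbits_subset:
  assumes "\<And>g x. g \<in> carrier G \<Longrightarrow> x \<in> E \<Longrightarrow> \<phi> g x \<in> E" and "Q \<in> orbits G E \<phi>"
  shows "Q \<subseteq> E"
  using assms unfolding orbits_def orbit_def by auto

text \<open>The image of the orbit of \<open>x\<close> is the orbit of \<open>h x\<close>. This is
  why unlabeled structures can be transported by taking images of orbits.\<close>

lemma orbits_equivariant_image:
  assumes into: "\<And>x. x \<in> E \<Longrightarrow> h x \<in> E'"
    and equi: "\<And>g x. g \<in> carrier G \<Longrightarrow> x \<in> E \<Longrightarrow> h (\<phi> g x) = \<psi> g (h x)"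
    and Q: "Q \<in> orbits G E \<phi>"
  shows "h ` Q \<in> orbits G E' \<psi>"
proof -
  obtain x where x: "x \<in> E" "Q = orbit G \<phi> x" using Q by (auto simp: orbits_def)
  have "h ` Q = orbit G \<psi> (h x)"
    unfolding x(2) orbit_def Setcompr_eq_image image_image using equi x(1) by (intro image_cong) auto
  then show ?thesis using into x by (auto simp: orbits_def)
qed

text \<open>The axioms of \<open>H\<close> speak only of its structures; the inclusion makes them
  applicable to every member of an orbit.\<close>

lemma unlabel_X_orbit_subset:
  assumes H: "species2 H" and V: "finite V"
    and Q: "Q \<in> orbits (sym_group n) (structs2 H {1..n} V) (\<lambda>\<pi>. transport2 H {1..n} V \<pi> id)"
  shows "Q \<subseteq> structs2 H {1..n} V"
proof (rule orbits_subset[OF _ Q])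
  fix \<pi> x assume "\<pi> \<in> carrier (sym_group n)" and x: "x \<in> structs2 H {1..n} V"
  then have "bij_betw \<pi> {1..n} {1..n}" by (simp add: sym_group_def permutes_imp_bij)
  then show "transport2 H {1..n} V \<pi> id x \<in> structs2 H {1..n} V"
    using bij_betwE[OF species2D(2)[OF H _ V _ bij_betw_id]] x by blast
qed

text \<open>The functor laws descend from \<open>H\<close> elementwise through images of orbits.
  Finiteness is the one point beyond this: the disjoint union over \<open>n\<close> must have only
  finitely many nonempty summands.\<close>

lemma species_unlabel_X:
  fixes H :: "(nat, 'y, 'h) species2_data"
  assumes H: "species2 H"
    and ev: "\<And>V. finite V \<Longrightarrow> \<forall>\<^sub>F n in sequentially. structs2 H {1..n} V = {}"
  shows "species (unlabel_X H)"
proof (rule speciesI)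
  let ?O = "\<lambda>n V. orbits (sym_group n) (structs2 H {1..n} V) (\<lambda>\<pi>. transport2 H {1..n} V \<pi> id)"
  fix V :: "'y set" assume V: "finite V"
  \<comment> \<open>The bound \<open>N\<close>, which may depend on \<open>V\<close>, truncates the
    disjoint union to the summands with \<open>n < N\<close>.\<close>
  obtain N where N: "\<And>n. n \<ge> N \<Longrightarrow> structs2 H {1..n} V = {}"
    using ev[OF V] by (auto simp: eventually_sequentially)
  have "?O n V = {}" if "n \<ge> N" for n
    unfolding orbits_def N[OF that] by simp
  then have "n < N" if "Q \<in> ?O n V" for n Q
    using that by (metis empty_iff not_le)
  then have "(SIGMA n:UNIV. ?O n V) = (SIGMA n:{..<N}. ?O n V)"
    by (intro equalityI subsetI; elim SigmaE; simp)
  moreover have "finite (?O n V)" for n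
    using species2D(1)[OF H _ V] by (simp add: orbits_def Setcompr_eq_image)
  ultimately show "finite (structs (unlabel_X H) V)" by (simp add: unlabel_X_def)
next
  fix U V :: "'y set" and \<sigma> s
  assume U: "finite U" and b: "bij_betw \<sigma> U V" and "s \<in> structs (unlabel_X H) U"
  then obtain n Q where s: "s = (n, Q)"
    and Q: "Q \<in> orbits (sym_group n) (structs2 H {1..n} U) (\<lambda>\<pi>. transport2 H {1..n} U \<pi> id)"
    by (auto simp: unlabel_X_def)
  have "transport2 H {1..n} U id \<sigma> ` Q \<in>
      orbits (sym_group n) (structs2 H {1..n} V) (\<lambda>\<pi>. transport2 H {1..n} V \<pi> id)"
  proof (rule orbits_equivariant_image[OF _ _ Q])
    fix x assume "x \<in> structs2 H {1..n} U"
    then show "transport2 H {1..n} U id \<sigma> x \<in> structs2 H {1..n} V"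
      using bij_betwE[OF species2D(2)[OF H _ U bij_betw_id b]] by blast
  next
    fix \<pi> x assume "\<pi> \<in> carrier (sym_group n)" and x: "x \<in> structs2 H {1..n} U"
    then have \<pi>: "bij_betw \<pi> {1..n} {1..n}" by (simp add: sym_group_def permutes_imp_bij)
    \<comment> \<open>Both sides are the transport along the pair of \<pi> and \<sigma>, factored in
      the two possible orders.\<close>
    show "transport2 H {1..n} U id \<sigma> (transport2 H {1..n} U \<pi> id x) =
        transport2 H {1..n} V \<pi> id (transport2 H {1..n} U id \<sigma> x)"
      using species2D(4)[OF H _ U x \<pi> bij_betw_id bij_betw_id b]
        species2D(4)[OF H _ U x bij_betw_id \<pi> b bij_betw_id] by simp
  qed
  then show "transport (unlabel_X H) U \<sigma> s \<in> structs (unlabel_X H) V"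
    by (simp add: s unlabel_X_def)
next
  fix U s assume U: "finite U" and "s \<in> structs (unlabel_X H) U"
  then obtain n Q where s: "s = (n, Q)" and Q: "Q \<subseteq> structs2 H {1..n} U"
    using unlabel_X_orbit_subset[OF H] by (auto simp: unlabel_X_def)
  have "transport2 H {1..n} U id id ` Q = id ` Q"
    by (rule image_cong) (use species2D(3)[OF H _ U] Q in auto)
  then show "transport (unlabel_X H) U id s = s" by (simp add: s unlabel_X_def)
next
  fix U V W :: "'y set" and \<sigma> \<tau> s
  assume U: "finite U" and "s \<in> structs (unlabel_X H) U"
    and b: "bij_betw \<sigma> U V" "bij_betw \<tau> V W"
  then obtain n Q where s: "s = (n, Q)" and Q: "Q \<subseteq> structs2 H {1..n} U"
    using unlabel_X_orbit_subset[OF H] by (auto simp: unlabel_X_def)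
  have "transport2 H {1..n} U id (\<tau> \<circ> \<sigma>) x =
      transport2 H {1..n} V id \<tau> (transport2 H {1..n} U id \<sigma> x)" if "x \<in> Q" for x
    using species2D(4)[OF H _ U _ bij_betw_id bij_betw_id b] that Q by auto
  then show "transport (unlabel_X H) U (\<tau> \<circ> \<sigma>) s =
      transport (unlabel_X H) V \<tau> (transport (unlabel_X H) U \<sigma> s)"
    by (simp add: s unlabel_X_def image_image)
next
  fix U V :: "'y set" and \<sigma> \<sigma>' s
  assume U: "finite U" and "s \<in> structs (unlabel_X H) U" and b: "bij_betw \<sigma> U V"
    and eq: "\<And>u. u \<in> U \<Longrightarrow> \<sigma> u = \<sigma>' u"
  then obtain n Q where s: "s = (n, Q)" and Q: "Q \<subseteq> structs2 H {1..n} U"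
    using unlabel_X_orbit_subset[OF H] by (auto simp: unlabel_X_def)
  have "transport2 H {1..n} U id \<sigma> x = transport2 H {1..n} U id \<sigma>' x" if "x \<in> Q" for x
    by (rule species2D(5)[OF H _ U _ bij_betw_id b refl eq]) (use that Q in auto)
  then show "transport (unlabel_X H) U \<sigma> s = transport (unlabel_X H) U \<sigma>' s"
    by (simp add: s unlabel_X_def)
qed

section \<open>Comparison of the analytic functor and the inner plethysm\<close>

lemma structs2_cart_X_Phi:
  "structs2 (F \<times>\<^sub>X Phi G) U V = structs F U \<times> (U \<rightarrow>\<^sub>E structs G V)"
  by (simp add: cart_X_def Phi_def)

text \<open>The values of \<open>f\<close> are \<open>G\<close>-structures, which transport along
  \<open>id\<close> fixes. Only precomposition with the inverse of \<pi> remains.\<close>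

lemma transport2_cart_X_Phi_points:
  assumes G: "species G" and V: "finite V" and \<pi>: "\<pi> permutes {1..n}"
    and x: "x \<in> structs2 (F \<times>\<^sub>X Phi G) {1..n} V"
  shows "transport2 (F \<times>\<^sub>X Phi G) {1..n} V \<pi> id x = analytic_action F n \<pi> x"
proof -
  obtain t f where tf: "x = (t, f)" and f: "f \<in> {1..n} \<rightarrow>\<^sub>E structs G V"
    using x by (auto simp: structs2_cart_X_Phi)
  \<comment> \<open>\<open>Phi\<close> restricts functions to the image of the points under \<pi>.
    Here this is \<open>{1..n}\<close>, the set to which \<open>analytic_action\<close> restricts;
    the equation also keeps \<open>inv_into\<close> inside it.\<close>
  have im: "\<pi> ` {1..n} = {1..n}" by (rule permutes_image[OF \<pi>])
  have "transport G V id (f (inv_into {1..n} \<pi> i)) = f (inv_into {1..n} \<pi> i)" if "i \<in> {1..n}" for i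
    using speciesD(3)[OF G V] f inv_into_into[of i \<pi> "{1..n}"] im that by blast
  then have "compose {1..n} (transport G V id \<circ> f) (inv_into {1..n} \<pi>) =
      compose {1..n} f (inv_into {1..n} \<pi>)"
    by (auto simp: compose_def fun_eq_iff)
  then show ?thesis using im by (simp add: tf cart_X_def Phi_def analytic_action_def)
qed

lemma transport2_cart_X_Phi_labels:
  assumes F: "species F" and U: "finite U" and t: "t \<in> structs F U"
  shows "transport2 (F \<times>\<^sub>X Phi G) U V id \<sigma> (t, f) = (t, compose U (transport G V \<sigma>) f)"
proof -
  \<comment> \<open>\<open>inv_into U id\<close> is known to be the identity on \<open>U\<close>
    only, which suffices because \<open>compose U\<close> restricts to \<open>U\<close>.\<close>
  have "inv_into U id u = u" if "u \<in> U" for u using inv_into_f_f[of id U u] that by simp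
  then have "compose U (transport G V \<sigma> \<circ> f) (inv_into U id) = compose U (transport G V \<sigma>) f"
    by (auto simp: compose_def fun_eq_iff)
  then show ?thesis using speciesD(3)[OF F U t] by (simp add: cart_X_def Phi_def)
qed

text \<open>For each \<open>n\<close> both sides collect orbits of the same set, under two actions
  of the symmetric group that agree on it.\<close>

lemma structs_inner_plethysm:
  assumes G: "species G" and V: "finite V"
  shows "structs (F \<boxtimes> G) V = structs (F \<circ>\<^sub>A G) V"
proof -
  have "orbits (sym_group n) (structs2 (F \<times>\<^sub>X Phi G) {1..n} V)
        (\<lambda>\<pi>. transport2 (F \<times>\<^sub>X Phi G) {1..n} V \<pi> id) =
      orbits (sym_group n) (structs2 (F \<times>\<^sub>X Phi G) {1..n} V) (analytic_action F n)" for n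
    by (rule orbits_cong, rule transport2_cart_X_Phi_points[OF G V]) (auto simp: sym_group_def)
  then show ?thesis
    by (simp add: inner_plethysm_def scalar_X_def unlabel_X_def analytic_comp_def analytic_obj_def
        structs2_cart_X_Phi)
qed

text \<open>Both transports take the image of the orbit \<open>Q\<close>. The two maps agree on
  genuine structures, and membership of \<open>s\<close> puts \<open>Q\<close> among these.\<close>

lemma transport_inner_plethysm:
  assumes F: "species F" and G: "species G" and V: "finite V" and s: "s \<in> structs (F \<boxtimes> G) V"
  shows "transport (F \<boxtimes> G) V \<sigma> s = transport (F \<circ>\<^sub>A G) V \<sigma> s"
proof -
  obtain n Q where nQ: "s = (n, Q)" and Q: "Q \<subseteq> structs2 (F \<times>\<^sub>X Phi G) {1..n} V"
    using s unlabel_X_orbit_subset[OF species2_cart[OF F species2_Phi[OF G]] V]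
    by (auto simp: inner_plethysm_def scalar_X_def unlabel_X_def)
  have "transport2 (F \<times>\<^sub>X Phi G) {1..n} V id \<sigma> ` Q =
      (\<lambda>(t, f). (t, compose {1..n} (transport G V \<sigma>) f)) ` Q"
  proof (rule image_cong)
    fix x assume "x \<in> Q"
    then obtain t f where "x = (t, f)" "t \<in> structs F {1..n}"
      using Q by (auto simp: structs2_cart_X_Phi)
    then show "transport2 (F \<times>\<^sub>X Phi G) {1..n} V id \<sigma> x =
        (\<lambda>(t, f). (t, compose {1..n} (transport G V \<sigma>) f)) x"
      using transport2_cart_X_Phi_labels[OF F, of "{1..n}"] by simp
  qed simp
  then show ?thesis
    by (simp add: nQ inner_plethysm_def scalar_X_def unlabel_X_def analytic_comp_def analytic_map_def)
qed

section \<open>Strict finiteness and the isomorphism\<close>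

lemma species_inner_plethysm:
  assumes F: "species F" and G: "species G" and fin: "strictly_finite F"
  shows "species (F \<boxtimes> G)"
  unfolding inner_plethysm_def scalar_X_def
proof (rule species_unlabel_X)
  show "species2 (F \<times>\<^sub>X Phi G)" by (rule species2_cart[OF F species2_Phi[OF G]])
  show "\<forall>\<^sub>F n in sequentially. structs2 (F \<times>\<^sub>X Phi G) {1..n} V = {}" for V
    \<comment> \<open>An empty factor \<open>structs F {1..n}\<close> empties the whole product, so
      the bound for \<open>F\<close> serves every \<open>V\<close>.\<close>
    using fin unfolding strictly_finite_def structs2_cart_X_Phi by (rule eventually_mono) simp
qed

theorem lemma2p13:
  fixes F :: "(nat, 's) species_data" and G :: "('b, 'g) species_data"
  assumes "species F" and "species G" and "strictly_finite F"
  shows "species (F \<circ>\<^sub>A G) \<and> species (F \<boxtimes> G) \<and> (\<exists>\<alpha>. species_iso \<alpha> (F \<circ>\<^sub>A G) (F \<boxtimes> G))"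
proof (intro conjI exI)
  note s = structs_inner_plethysm[OF assms(2)] and t = transport_inner_plethysm[OF assms(1,2)]
  show P: "species (F \<boxtimes> G)" by (rule species_inner_plethysm[OF assms])
  \<comment> \<open>The axioms are inherited from the inner plethysm, so the analytic side needs no
    separate equivariance or finiteness argument.\<close>
  show "species (F \<circ>\<^sub>A G)" by (rule species_cong[OF P s t])
  show "species_iso (\<lambda>V s. s) (F \<circ>\<^sub>A G) (F \<boxtimes> G)"
    \<comment> \<open>The side condition of \<open>t\<close> is membership in the inner plethysm,
      which \<open>s\<close> rewrites to membership on the analytic side.\<close>
    by (rule species_iso_identity) (simp_all add: s t)
qed

end
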